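(* Let $G,H$ be TSI Polish groups each containing at least two elements, and let $G_c$ and $H_c$ be open normal subgroups of $G$ and $H$ respectively. If there exists a topological group isomorphism $\phi:G_c\to H_c$ such that $\phi\,\mathrm{Inn}_G(G_c)\,\phi^{-1}\subseteq\mathrm{Inn}_H(H_c)$, then $E_*(G)\le_B E_*(H)$.
   Context: For a Polish group $G$, $E_*(G)$ is the equivalence relation on $G^\omega$ given by $x\,E_*(G)\,y$ iff $\lim_n x(0)x(1)\cdots x(n)y(n)^{-1}\cdots y(1)^{-1}y(0)^{-1}$ converges in $G$. For $u\in G$, $\iota_u:G_c\to G_c$ is $\iota_u(g)=ugu^{-1}$, and $\mathrm{Inn}_G(G_c)=\{\iota_u:u\in G\}$. TSI: admits a compatible two-sided invariant metric. $\le_B$ is Borel reducibility. *)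

theory Defs
  imports "HOL-Analysis.Analysis" "HOL-Algebra.Coset"
begin

definition separable_space :: "'a topology \<Rightarrow> bool" where
  "separable_space X \<longleftrightarrow>
     (\<exists>D. countable D \<and> D \<subseteq> topspace X \<and> Abstract_Topology.closure_of X D = topspace X)"

definition polish_topology :: "'a topology \<Rightarrow> bool" where
  "polish_topology X \<longleftrightarrow> separable_space X \<and> completely_metrizable_space X"

locale topological_group = group G for G (structure) +
  fixes T :: "'a topology"
  assumes topspace_eq: "topspace T = carrier G"
    and continuous_mult: "continuous_map (prod_topology T T) T (\<lambda>(x, y). x \<otimes> y)"
    and continuous_inv: "continuous_map T T (\<lambda>x. inv x)"

locale polish_group = topological_group +
  assumes polish: "polish_topology T"

locale tsi_polish_group = polish_group +
  assumes tsi: "\<exists>d. Metric_space (carrier G) d \<and> Metric_space.mtopology (carrier G) d = T \<and>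
    (\<forall>g\<in>carrier G. \<forall>h\<in>carrier G. \<forall>x\<in>carrier G. \<forall>y\<in>carrier G.
       d (g \<otimes> x \<otimes> h) (g \<otimes> y \<otimes> h) = d x y)"

definition top_subgroup_iso ::
  "('a, 'm) monoid_scheme \<Rightarrow> 'a topology \<Rightarrow> 'a set \<Rightarrow>
   ('b, 'n) monoid_scheme \<Rightarrow> 'b topology \<Rightarrow> 'b set \<Rightarrow> ('a \<Rightarrow> 'b) set" where
  "top_subgroup_iso G T A H S B =
     {f \<in> Group.iso (G\<lparr>carrier := A\<rparr>) (H\<lparr>carrier := B\<rparr>).
        homeomorphic_map (subtopology T A) (subtopology S B) f}"

text \<open>Maps on \<open>N\<close> are made extensional, so that equality of maps is equality on \<open>N\<close>.\<close>

definition conj_map :: "('a, 'm) monoid_scheme \<Rightarrow> 'a set \<Rightarrow> 'a \<Rightarrow> 'a \<Rightarrow> 'a" where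
  "conj_map G N u = (\<lambda>g\<in>N. u \<otimes>\<^bsub>G\<^esub> g \<otimes>\<^bsub>G\<^esub> inv\<^bsub>G\<^esub> u)"

definition Inn :: "('a, 'm) monoid_scheme \<Rightarrow> 'a set \<Rightarrow> ('a \<Rightarrow> 'a) set" where
  "Inn G N = conj_map G N ` carrier G"

definition conjugate_maps ::
  "'a set \<Rightarrow> 'b set \<Rightarrow> ('a \<Rightarrow> 'b) \<Rightarrow> ('a \<Rightarrow> 'a) set \<Rightarrow> ('b \<Rightarrow> 'b) set" where
  "conjugate_maps A B \<phi> F = (\<lambda>f. compose B \<phi> (compose B f (inv_into A \<phi>))) ` F"

primrec prod_seq :: "('a, 'm) monoid_scheme \<Rightarrow> (nat \<Rightarrow> 'a) \<Rightarrow> nat \<Rightarrow> 'a" where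
  "prod_seq G x 0 = x 0"
| "prod_seq G x (Suc n) = prod_seq G x n \<otimes>\<^bsub>G\<^esub> x (Suc n)"

primrec prod_inv_seq :: "('a, 'm) monoid_scheme \<Rightarrow> (nat \<Rightarrow> 'a) \<Rightarrow> nat \<Rightarrow> 'a" where
  "prod_inv_seq G y 0 = inv\<^bsub>G\<^esub> (y 0)"
| "prod_inv_seq G y (Suc n) = inv\<^bsub>G\<^esub> (y (Suc n)) \<otimes>\<^bsub>G\<^esub> prod_inv_seq G y n"

abbreviation omega_power :: "'a topology \<Rightarrow> (nat \<Rightarrow> 'a) topology" where
  "omega_power T \<equiv> product_topology (\<lambda>_. T) UNIV"

definition E_star ::
  "('a, 'm) monoid_scheme \<Rightarrow> 'a topology \<Rightarrow> ((nat \<Rightarrow> 'a) \<times> (nat \<Rightarrow> 'a)) set" where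
  "E_star G T = {(x, y). x \<in> topspace (omega_power T) \<and> y \<in> topspace (omega_power T) \<and>
     (\<exists>l. limitin T (\<lambda>n. prod_seq G x n \<otimes>\<^bsub>G\<^esub> prod_inv_seq G y n) l sequentially)}"

definition borel_of :: "'a topology \<Rightarrow> 'a measure" where
  "borel_of X = sigma (topspace X) {U. openin X U}"

definition borel_reducible ::
  "'a topology \<Rightarrow> ('a \<times> 'a) set \<Rightarrow> 'b topology \<Rightarrow> ('b \<times> 'b) set \<Rightarrow> bool" where
  "borel_reducible X E Y F \<longleftrightarrow>
     (\<exists>f \<in> borel_of X \<rightarrow>\<^sub>M borel_of Y.
        \<forall>x\<in>topspace X. \<forall>y\<in>topspace X. (x, y) \<in> E \<longleftrightarrow> (f x, f y) \<in> F)"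

end

theory Submission
  imports Defs
begin

text \<open>
  Choose coset representatives for \<open>G\<^sub>c\<close> and, for each representative \<open>r\<close>, some \<open>v r\<close> in \<open>H\<close>
  with \<open>\<phi> \<circ> \<iota>\<^sub>r \<circ> \<phi>\<inverse> = \<iota>\<^sub>v\<^sub>r\<close>; put \<open>\<psi> (c \<otimes> r) = \<phi> c \<otimes> v r\<close>. Although \<open>\<psi>\<close> is not a homomorphism,
  when \<open>x\<close> and \<open>y\<close> lie in the same cosets from some index on, \<open>\<phi>\<close> carries the tail of
  \<open>x 0 \<cdots> x n \<otimes> inv (y 0 \<cdots> y n)\<close> to the corresponding tail for \<open>\<psi> \<circ> x\<close> and \<open>\<psi> \<circ> y\<close>, because
  the conjugations by representatives match. Sequences related by \<open>E\<^sub>*(G)\<close> do eventually lie in the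
  same cosets, as \<open>G\<^sub>c\<close> is open. There are countably many cosets, so the sequence of cosets of \<open>x\<close>,
  modulo finite changes, is coded by bits (the graph of the sequence of coset indices), and these
  are interleaved with \<open>\<psi> \<circ> x\<close> as factors \<open>a, inv a\<close> with a fixed \<open>a \<noteq> \<one>\<close> in \<open>H\<close>. The resulting
  reduction is continuous.
\<close>

section \<open>Partial products in a group\<close>

lemma (in group) inv_mult_cancel_left [simp]:
  "\<lbrakk>x \<in> carrier G; y \<in> carrier G\<rbrakk> \<Longrightarrow> inv x \<otimes> (x \<otimes> y) = y"
  by (simp flip: m_assoc)

lemma (in group) mult_inv_cancel_left [simp]:
  "\<lbrakk>x \<in> carrier G; y \<in> carrier G\<rbrakk> \<Longrightarrow> x \<otimes> (inv x \<otimes> y) = y"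
  by (simp flip: m_assoc)

lemma (in group) prod_seq_closed [simp]:
  "(\<And>n. x n \<in> carrier G) \<Longrightarrow> prod_seq G x n \<in> carrier G"
  by (induction n) auto

lemma (in group) prod_inv_seq_eq:
  "(\<And>n. y n \<in> carrier G) \<Longrightarrow> prod_inv_seq G y n = inv (prod_seq G y n)"
  by (induction n) (auto simp: inv_mult_group)

section \<open>Limits, open subgroups and cosets in a topological group\<close>

context topological_group
begin

lemma topspace_omega_power_iff: "x \<in> topspace (omega_power T) \<longleftrightarrow> (\<forall>n. x n \<in> carrier G)"
  by (auto simp: topspace_eq)

lemma E_star_iff:
  assumes "\<And>n. x n \<in> carrier G" "\<And>n. y n \<in> carrier G"
  shows "(x, y) \<in> E_star G T \<longleftrightarrow>
    (\<exists>l. limitin T (\<lambda>n. prod_seq G x n \<otimes> inv (prod_seq G y n)) l sequentially)"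
  using assms by (simp add: E_star_def topspace_eq prod_inv_seq_eq PiE_UNIV_domain Pi_def)

lemma continuous_map_mult:
  assumes "continuous_map X T f" "continuous_map X T g"
  shows "continuous_map X T (\<lambda>x. f x \<otimes> g x)"
proof -
  have "continuous_map X T ((\<lambda>(x, y). x \<otimes> y) \<circ> (\<lambda>x. (f x, g x)))"
    using assms continuous_mult
    by (intro continuous_map_compose) (auto simp: continuous_map_pairedI)
  then show ?thesis by (simp add: o_def)
qed

lemma continuous_map_inv:
  assumes "continuous_map X T f"
  shows "continuous_map X T (\<lambda>x. inv (f x))"
  using continuous_map_compose[OF assms continuous_inv] by (simp add: o_def)

lemma continuous_map_translate:
  assumes "a \<in> carrier G" "b \<in> carrier G"
  shows "continuous_map T T (\<lambda>x. a \<otimes> x \<otimes> b)"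
  using assms by (intro continuous_map_mult) (auto simp: topspace_eq)

lemma limitin_translate:
  assumes "a \<in> carrier G" "b \<in> carrier G" "limitin T f l F"
  shows "limitin T (\<lambda>n. a \<otimes> f n \<otimes> b) (a \<otimes> l \<otimes> b) F"
  using continuous_map_limit[OF continuous_map_translate[OF assms(1,2)] assms(3)]
  by (simp add: o_def)

text \<open>Translation by \<open>inv a\<close> and \<open>inv b\<close> undoes the change. This
  later allows a fixed initial block of factors to be stripped from the products in
  \<open>E_star\<close>.\<close>

lemma convergent_translate_iff:
  assumes "a \<in> carrier G" "b \<in> carrier G" "\<And>n. f n \<in> carrier G"
  shows "(\<exists>l. limitin T (\<lambda>n. a \<otimes> f n \<otimes> b) l F) \<longleftrightarrow> (\<exists>l. limitin T f l F)"
proof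
  assume "\<exists>l. limitin T (\<lambda>n. a \<otimes> f n \<otimes> b) l F"
  then obtain l where "limitin T (\<lambda>n. a \<otimes> f n \<otimes> b) l F" ..
  from limitin_translate[of "inv a" "inv b", OF _ _ this]
  show "\<exists>l. limitin T f l F"
    using assms by (auto simp: m_assoc)
next
  show "\<exists>l. limitin T f l F \<Longrightarrow> \<exists>l. limitin T (\<lambda>n. a \<otimes> f n \<otimes> b) l F"
    using assms limitin_translate by blast
qed

lemma openin_coset:
  assumes "openin T N" "h \<in> carrier G"
  shows "openin T {g \<in> carrier G. g \<otimes> inv h \<in> N}"
  using openin_continuous_map_preimage[OF continuous_map_translate[of \<one> "inv h"] assms(1)] assms(2)
  by (simp add: topspace_eq cong: conj_cong)

lemma eventually_in_coset_of_limit: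
  assumes "openin T N" "\<one> \<in> N" "limitin T f l F"
  shows "\<forall>\<^sub>F n in F. f n \<in> carrier G \<and> f n \<otimes> inv l \<in> N"
proof -
  have l: "l \<in> carrier G"
    using limitin_topspace[OF assms(3)] by (simp add: topspace_eq)
  have "l \<in> {g \<in> carrier G. g \<otimes> inv l \<in> N}"
    using assms(2) l by simp
  then have "\<forall>\<^sub>F n in F. f n \<in> {g \<in> carrier G. g \<otimes> inv l \<in> N}"
    using assms(3) openin_coset[OF assms(1) l] unfolding limitin_def by blast
  then show ?thesis by simp
qed

text \<open>Open subgroups are closed: the coset of \<open>l\<close> is a neighbourhood of
  \<open>l\<close>, so some value \<open>u\<close> lies both in \<open>N\<close> and in that coset,
  whence \<open>l = inv (u \<otimes> inv l) \<otimes> u\<close> is in \<open>N\<close>.\<close>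

lemma limitin_open_subgroup:
  assumes N: "subgroup N G" "openin T N" and f: "\<And>n. n \<ge> n0 \<Longrightarrow> f n \<in> N"
    and lim: "limitin T f l sequentially"
  shows "l \<in> N"
proof -
  interpret subgroup N G by fact
  have l: "l \<in> carrier G"
    using limitin_topspace[OF lim] by (simp add: topspace_eq)
  obtain n1 where n1: "\<And>n. n \<ge> n1 \<Longrightarrow> f n \<in> carrier G \<and> f n \<otimes> inv l \<in> N"
    using eventually_in_coset_of_limit[OF N(2) one_closed lim]
    by (auto simp: eventually_sequentially)
  define u where "u = f (max n0 n1)"
  have u: "u \<in> N" "u \<otimes> inv l \<in> N"
    using n1 f by (auto simp: u_def)
  then have "inv (u \<otimes> inv l) \<otimes> u \<in> N"
    by blast
  then show ?thesis
    using u(1) l by (simp add: inv_mult_group m_assoc)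
qed

text \<open>The quotients \<open>?a n\<close> eventually stay in the open coset of their limit, so
  consecutive ones differ by an element of \<open>N\<close>; that element is a conjugate of
  \<open>x (Suc n) \<otimes> inv (y (Suc n))\<close>, and \<open>N\<close> is normal.\<close>

lemma E_star_imp_eventually_same_coset:
  assumes N: "N \<lhd> G" "openin T N" and E: "(x, y) \<in> E_star G T"
  shows "\<forall>\<^sub>F n in sequentially. x n \<otimes> inv (y n) \<in> N"
proof -
  interpret normal N G by fact
  have x: "x n \<in> carrier G" and y: "y n \<in> carrier G" for n
    using E unfolding E_star_def topspace_omega_power_iff by auto
  let ?a = "\<lambda>n. prod_seq G x n \<otimes> inv (prod_seq G y n)"
  obtain l where l: "limitin T ?a l sequentially"
    using E E_star_iff[of x y] x y by blast
  have lc: "l \<in> carrier G"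
    using limitin_topspace[OF l] by (simp add: topspace_eq)
  obtain n0 where n0: "\<And>n. n \<ge> n0 \<Longrightarrow> ?a n \<otimes> inv l \<in> N"
    using eventually_in_coset_of_limit[OF N(2) one_closed l]
    by (auto simp: eventually_sequentially)
  have "x (Suc n) \<otimes> inv (y (Suc n)) \<in> N" if "n \<ge> n0" for n
  proof -
    define p q where "p = prod_seq G x n" and "q = prod_seq G y n"
    have pq [simp]: "p \<in> carrier G" "q \<in> carrier G"
      using x y by (auto simp: p_def q_def)
    have "?a (Suc n) \<otimes> inv l \<otimes> inv (?a n \<otimes> inv l) \<in> N"
      using n0[OF that] n0[of "Suc n"] that by (blast intro: le_SucI)
    \<comment> \<open>The limit and the factor \<open>q\<close> cancel, leaving a conjugate by
      \<open>p\<close>.\<close>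
    also have "?a (Suc n) \<otimes> inv l \<otimes> inv (?a n \<otimes> inv l) = p \<otimes> (x (Suc n) \<otimes> inv (y (Suc n))) \<otimes> inv p"
      using x y lc by (simp add: p_def[symmetric] q_def[symmetric] inv_mult_group m_assoc)
    finally have "inv p \<otimes> (p \<otimes> (x (Suc n) \<otimes> inv (y (Suc n))) \<otimes> inv p) \<otimes> p \<in> N"
      by (rule inv_op_closed1[rotated]) simp
    then show ?thesis
      using x y by (simp add: m_assoc)
  qed
  then have "\<forall>n\<ge>Suc n0. x n \<otimes> inv (y n) \<in> N"
    by (metis Suc_le_D Suc_le_mono)
  then show ?thesis
    by (auto simp: eventually_sequentially)
qed

text \<open>Continuity of \<open>\<phi>\<close> is available on \<open>N\<close>; since the open
  subgroup \<open>N\<close> is closed, \<open>l\<close> is in \<open>N\<close> and the convergence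
  takes place in the subspace.\<close>

lemma limitin_continuous_image_open_subgroup:
  assumes N: "subgroup N G" "openin T N" and f: "\<And>n. n \<ge> n0 \<Longrightarrow> f n \<in> N"
    and lim: "limitin T f l sequentially"
    and \<phi>: "continuous_map (subtopology T N) Y \<phi>"
  shows "limitin Y (\<lambda>n. \<phi> (f n)) (\<phi> l) sequentially"
proof -
  have "limitin (subtopology T N) f l sequentially"
    unfolding limitin_subtopology
    using limitin_open_subgroup[OF N f lim] f lim by (auto simp: eventually_sequentially)
  from continuous_map_limit[OF \<phi> this] show ?thesis
    by (simp add: o_def)
qed

end

section \<open>Countability of the cosets of an open subgroup\<close>

text \<open>Each coset is open, so it meets a countable dense set \<open>D\<close>; the code of a
  coset is the index in \<open>D\<close> of a chosen point of it.\<close>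

lemma (in polish_group) coset_code_exists:
  assumes N: "subgroup N G" "openin T N"
  obtains code :: "'a \<Rightarrow> nat"
  where "\<And>g h. \<lbrakk>g \<in> carrier G; h \<in> carrier G\<rbrakk> \<Longrightarrow> code g = code h \<longleftrightarrow> g \<otimes> inv h \<in> N"
proof -
  interpret subgroup N G by fact
  obtain D where D: "countable D" "D \<subseteq> carrier G" "Abstract_Topology.closure_of T D = carrier G"
    using polish unfolding polish_topology_def separable_space_def topspace_eq by auto
  let ?P = "\<lambda>g d. d \<in> D \<and> d \<otimes> inv g \<in> N"
  have ex: "\<exists>d. ?P g d" if g: "g \<in> carrier G" for g
  proof -
    have "g \<in> {h \<in> carrier G. h \<otimes> inv g \<in> N}"
      using g by simp
    moreover have "g \<in> Abstract_Topology.closure_of T D"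
      using D(3) g by simp
    ultimately show ?thesis
      using openin_coset[OF N(2) g] unfolding in_closure_of by (metis (lifting) mem_Collect_eq)
  qed
  define s where "s g = (SOME d. ?P g d)" for g
  have s: "s g \<in> carrier G" "s g \<in> D" "s g \<otimes> inv g \<in> N" if "g \<in> carrier G" for g
    using someI_ex[OF ex[OF that]] D(2) by (auto simp: s_def)
  note sub_mult = subgroup.m_closed[OF N(1)] and sub_inv = subgroup.m_inv_closed[OF N(1)]
  have cong: "s g = s h" if g: "g \<in> carrier G" and h: "h \<in> carrier G" and gh: "g \<otimes> inv h \<in> N" for g h
  proof -
    have "d \<otimes> inv g \<in> N \<longleftrightarrow> d \<otimes> inv h \<in> N" if d: "d \<in> carrier G" for d
    proof
      assume "d \<otimes> inv g \<in> N"
      from sub_mult[OF this gh] show "d \<otimes> inv h \<in> N"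
        using g h d by (simp add: m_assoc)
    next
      assume "d \<otimes> inv h \<in> N"
      from sub_mult[OF this sub_inv[OF gh]] show "d \<otimes> inv g \<in> N"
        using g h d by (simp add: m_assoc inv_mult_group)
    qed
    \<comment> \<open>Elements of one coset define the same predicate, so \<open>SOME\<close>
      chooses the same point for them.\<close>
    then have "?P g = ?P h"
      using D(2) by (auto simp: fun_eq_iff)
    then show ?thesis
      by (simp only: s_def)
  qed
  have "to_nat_on D (s g) = to_nat_on D (s h) \<longleftrightarrow> g \<otimes> inv h \<in> N"
    if g: "g \<in> carrier G" and h: "h \<in> carrier G" for g h
  proof
    assume "to_nat_on D (s g) = to_nat_on D (s h)"
    then have eq: "s g = s h"
      using D(1) s(2)[OF g] s(2)[OF h] by simp
    from sub_mult[OF sub_inv[OF s(3)[OF g]] s(3)[OF h]]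
    show "g \<otimes> inv h \<in> N"
      using s(1)[OF h] g h by (simp add: eq inv_mult_group m_assoc)
  next
    assume "g \<otimes> inv h \<in> N"
    from cong[OF g h this] show "to_nat_on D (s g) = to_nat_on D (s h)"
      by simp
  qed
  then show thesis by (rule that)
qed

section \<open>Interleaving a sequence with bits\<close>

definition interleave :: "('a, 'm) monoid_scheme \<Rightarrow> (nat \<Rightarrow> 'a) \<Rightarrow> (nat \<Rightarrow> 'a) \<Rightarrow> nat \<Rightarrow> 'a" where
  "interleave G h e n =
     (if even n then h (n div 2) \<otimes>\<^bsub>G\<^esub> e (n div 2) else inv\<^bsub>G\<^esub> (e (n div 2)))"

lemma (in group) interleave_closed [simp]:
  "\<lbrakk>\<And>n. h n \<in> carrier G; \<And>n. e n \<in> carrier G\<rbrakk> \<Longrightarrow> interleave G h e n \<in> carrier G"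
  by (simp add: interleave_def)

lemma (in group) prod_seq_interleave:
  assumes "\<And>n. h n \<in> carrier G" "\<And>n. e n \<in> carrier G"
  shows "prod_seq G (interleave G h e) (2 * n) = prod_seq G h n \<otimes> e n"
    and "prod_seq G (interleave G h e) (Suc (2 * n)) = prod_seq G h n"
proof -
  have even: "prod_seq G (interleave G h e) (2 * n) = prod_seq G h n \<otimes> e n" for n
  proof (induction n)
    case 0
    show ?case by (simp add: interleave_def)
  next
    case (Suc n)
    then show ?case using assms by (simp add: interleave_def m_assoc)
  qed
  show "prod_seq G (interleave G h e) (2 * n) = prod_seq G h n \<otimes> e n"
    by (fact even)
  show "prod_seq G (interleave G h e) (Suc (2 * n)) = prod_seq G h n"
    using assms by (simp add: even m_assoc) (simp add: interleave_def)
qed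

lemma limitin_interleaveI:
  assumes "limitin X (\<lambda>n. f (2 * n)) l sequentially" "limitin X (\<lambda>n. f (Suc (2 * n))) l sequentially"
  shows "limitin X f l sequentially"
  unfolding limitin_def
proof (intro conjI allI impI)
  show "l \<in> topspace X"
    using assms(1) by (rule limitin_topspace)
  fix U assume U: "openin X U \<and> l \<in> U"
  then obtain n1 n2 where n: "\<And>n. n \<ge> n1 \<Longrightarrow> f (2 * n) \<in> U" "\<And>n. n \<ge> n2 \<Longrightarrow> f (Suc (2 * n)) \<in> U"
    using assms unfolding limitin_def eventually_sequentially by meson
  have "f n \<in> U" if "n \<ge> Suc (2 * max n1 n2)" for n
    using that n by (cases "even n") (auto elim!: evenE oddE)
  then show "\<forall>\<^sub>F n in sequentially. f n \<in> U"
    by (auto simp: eventually_sequentially)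
qed

text \<open>
  The block \<open>h n \<otimes> e n, inv (e n)\<close> multiplies to \<open>h n\<close>, so it does not disturb the later
  partial products, but by two-sided invariance the intermediate one detects the distance
  from \<open>e n\<close> to \<open>e' n\<close>.
\<close>
lemma (in tsi_polish_group) E_star_interleave_iff:
  assumes h: "\<And>n. h n \<in> carrier G" "\<And>n. h' n \<in> carrier G"
    and a: "a \<in> carrier G" "a \<noteq> \<one>"
    and e: "\<And>n. e n \<in> {\<one>, a}" "\<And>n. e' n \<in> {\<one>, a}"
  shows "(interleave G h e, interleave G h' e') \<in> E_star G T \<longleftrightarrow>
    (h, h') \<in> E_star G T \<and> (\<forall>\<^sub>F n in sequentially. e n = e' n)"
proof -
  obtain d where d: "Metric_space (carrier G) d" "Metric_space.mtopology (carrier G) d = T"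
    and inv_d: "\<And>g h x y. \<lbrakk>g \<in> carrier G; h \<in> carrier G; x \<in> carrier G; y \<in> carrier G\<rbrakk>
        \<Longrightarrow> d (g \<otimes> x \<otimes> h) (g \<otimes> y \<otimes> h) = d x y"
    using tsi by blast
  interpret Metric_space "carrier G" d by fact
  have ec [simp]: "e n \<in> carrier G" "e' n \<in> carrier G" for n
    using e[of n] a by auto
  let ?a = "\<lambda>n. prod_seq G h n \<otimes> inv (prod_seq G h' n)"
  let ?b = "\<lambda>n. prod_seq G h n \<otimes> e n \<otimes> inv (prod_seq G h' n \<otimes> e' n)"
  let ?c = "\<lambda>n. prod_seq G (interleave G h e) n \<otimes> inv (prod_seq G (interleave G h' e') n)"
  have c: "?c (2 * n) = ?b n" "?c (Suc (2 * n)) = ?a n" for n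
    using h prod_seq_interleave[of h e] prod_seq_interleave[of h' e'] by simp_all
  \<comment> \<open>Inserting \<open>e' n\<close> and its inverse gives \<open>?a n\<close> the
    outer factors of \<open>?b n\<close>, so that the two differ only in the middle:
    \<open>e' n\<close> in place of \<open>e n\<close>.\<close>
  have ab: "?a n = prod_seq G h n \<otimes> e' n \<otimes> inv (prod_seq G h' n \<otimes> e' n)" for n
    using h by (simp add: inv_mult_group m_assoc)
  have "(\<exists>l. limitin T ?c l sequentially) \<longleftrightarrow>
    (\<exists>l. limitin T ?a l sequentially) \<and> (\<forall>\<^sub>F n in sequentially. e n = e' n)"
  proof safe
    fix l assume l: "limitin T ?c l sequentially"
    have "limitin T (?c \<circ> (\<lambda>n. 2 * n)) l sequentially"
      by (rule limitin_subsequence[OF _ l]) (simp add: strict_mono_def)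
    then have lb: "limitin T ?b l sequentially"
      by (simp add: o_def c)
    have "limitin T (?c \<circ> (\<lambda>n. Suc (2 * n))) l sequentially"
      by (rule limitin_subsequence[OF _ l]) (simp add: strict_mono_def)
    then have la: "limitin T ?a l sequentially"
      by (simp only: o_def c)
    then show "\<exists>l. limitin T ?a l sequentially" ..
    have lc: "l \<in> carrier G"
      using limitin_topspace[OF l] by (simp add: topspace_eq)
    \<comment> \<open>Distinct values in \<open>{\<one>, a}\<close> lie at distance
      \<open>d a \<one>\<close>, so a smaller distance forces equality; half of it is allotted to
      each of \<open>?a\<close> and \<open>?b\<close>.\<close>
    have pos: "d a \<one> > 0"
      using a by simp
    have "\<forall>\<^sub>F n in sequentially. ?a n \<in> carrier G \<and> d (?a n) l < d a \<one> / 2"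
      "\<forall>\<^sub>F n in sequentially. ?b n \<in> carrier G \<and> d (?b n) l < d a \<one> / 2"
      using la lb pos half_gt_zero[OF pos] unfolding d(2)[symmetric] limitin_metric by blast+
    then show "\<forall>\<^sub>F n in sequentially. e n = e' n"
    proof eventually_elim
      case (elim n)
      have "d (e n) (e' n) = d (?b n) (?a n)"
        unfolding ab using h by (subst inv_d) auto
      also have "\<dots> \<le> d (?b n) l + d (?a n) l"
        using elim lc triangle[of "?b n" l "?a n"] commute[of l "?a n"] by simp
      also have "\<dots> < d a \<one>"
        using elim by linarith
      finally show ?case
        using e[of n] commute[of a \<one>] by auto
    qed
  next
    fix l assume l: "limitin T ?a l sequentially" and ev: "\<forall>\<^sub>F n in sequentially. e n = e' n"
    \<comment> \<open>Where the bits agree, \<open>?a n\<close> and \<open>?b n\<close> coincide, so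
      both the odd and the even subsequence of \<open>?c\<close> tend to \<open>l\<close>.\<close>
    have "\<forall>\<^sub>F n in sequentially. ?a n = ?b n"
      using ev by eventually_elim (simp only: ab)
    then have "limitin T ?b l sequentially"
      by (rule limitin_transform_eventually) (rule l)
    with l have "limitin T ?c l sequentially"
      by (intro limitin_interleaveI[where f = ?c]) (simp_all only: c)
    then show "\<exists>l. limitin T ?c l sequentially" ..
  qed
  then show ?thesis
    using h by (subst (1 2) E_star_iff) auto
qed

section \<open>Intertwiners and the transfer of convergence\<close>

text \<open>\<open>\<psi>\<close> takes the place of a homomorphism extending \<open>\<phi>\<close>.
  Two traces of multiplicativity are kept: conjugation by \<open>g\<close> on \<open>N\<close>
  corresponds to conjugation by \<open>\<psi> g\<close>, and quotients within one coset of
  \<open>N\<close> are mapped by \<open>\<phi>\<close>.\<close>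

locale coset_intertwiner = G: topological_group G T + H: topological_group H S
  for G :: "('a, 'm) monoid_scheme" and T and H :: "('b, 'n) monoid_scheme" and S +
  fixes N :: "'a set" and M :: "'b set" and \<phi> \<psi> :: "'a \<Rightarrow> 'b"
  assumes N: "N \<lhd> G" "openin T N" and M: "subgroup M H" "openin S M"
    and hom: "\<And>c d. \<lbrakk>c \<in> N; d \<in> N\<rbrakk> \<Longrightarrow> \<phi> (c \<otimes>\<^bsub>G\<^esub> d) = \<phi> c \<otimes>\<^bsub>H\<^esub> \<phi> d"
    and homeo: "homeomorphic_map (subtopology T N) (subtopology S M) \<phi>"
    and closed: "\<And>g. g \<in> carrier G \<Longrightarrow> \<psi> g \<in> carrier H"
    and intertwine: "\<And>g c. \<lbrakk>g \<in> carrier G; c \<in> N\<rbrakk> \<Longrightarrow>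
      \<phi> (g \<otimes>\<^bsub>G\<^esub> c \<otimes>\<^bsub>G\<^esub> inv\<^bsub>G\<^esub> g) = \<psi> g \<otimes>\<^bsub>H\<^esub> \<phi> c \<otimes>\<^bsub>H\<^esub> inv\<^bsub>H\<^esub> (\<psi> g)"
    and coset: "\<And>g h. \<lbrakk>g \<in> carrier G; h \<in> carrier G; g \<otimes>\<^bsub>G\<^esub> inv\<^bsub>G\<^esub> h \<in> N\<rbrakk> \<Longrightarrow>
      \<phi> (g \<otimes>\<^bsub>G\<^esub> inv\<^bsub>G\<^esub> h) = \<psi> g \<otimes>\<^bsub>H\<^esub> inv\<^bsub>H\<^esub> (\<psi> h)"
begin

sublocale N: normal N G by (fact N)

sublocale M: subgroup M H by (fact M)

lemma maps_subgroup: "c \<in> N \<Longrightarrow> \<phi> c \<in> M"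
  using homeomorphic_imp_surjective_map[OF homeo] N.subset M.subset
  by (auto simp: G.topspace_eq H.topspace_eq)

text \<open>On the open coset of \<open>h\<close>, \<open>\<psi>\<close> is \<open>\<phi>\<close>
  composed with translations, namely \<open>\<phi> (g \<otimes> inv h) \<otimes> \<psi> h\<close>;
  the open cosets cover the group.\<close>

lemma continuous_map_intertwiner: "continuous_map T S \<psi>"
proof (rule pasting_lemma[where I = "carrier G" and T = "\<lambda>h. {g \<in> carrier G. g \<otimes>\<^bsub>G\<^esub> inv\<^bsub>G\<^esub> h \<in> N}"
      and f = "\<lambda>_. \<psi>"])
  fix h assume h: "h \<in> carrier G"
  let ?C = "{g \<in> carrier G. g \<otimes>\<^bsub>G\<^esub> inv\<^bsub>G\<^esub> h \<in> N}"
  show "openin T ?C"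
    using N(2) h by (rule G.openin_coset)
  have "continuous_map T T (\<lambda>g. g \<otimes>\<^bsub>G\<^esub> inv\<^bsub>G\<^esub> h)"
    using h by (intro G.continuous_map_mult) (auto simp: G.topspace_eq)
  then have tr: "continuous_map (subtopology T ?C) (subtopology T N) (\<lambda>g. g \<otimes>\<^bsub>G\<^esub> inv\<^bsub>G\<^esub> h)"
    by (auto simp: continuous_map_in_subtopology intro: continuous_map_from_subtopology)
  have "continuous_map (subtopology T N) S \<phi>"
    using homeomorphic_imp_continuous_map[OF homeo] by (simp add: continuous_map_in_subtopology)
  from continuous_map_compose[OF tr this]
  have "continuous_map (subtopology T ?C) S (\<lambda>g. \<phi> (g \<otimes>\<^bsub>G\<^esub> inv\<^bsub>G\<^esub> h) \<otimes>\<^bsub>H\<^esub> \<psi> h)"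
    using closed[OF h] by (intro H.continuous_map_mult) (auto simp: o_def H.topspace_eq)
  then show "continuous_map (subtopology T ?C) S \<psi>"
    by (rule continuous_map_eq) (use h coset closed in \<open>simp add: H.m_assoc\<close>)
qed (auto simp: G.topspace_eq)

text \<open>The factors up to index \<open>k\<close> contribute only fixed translations on both
  sides. The remaining quotient lies in \<open>N\<close>, and \<open>\<phi>\<close> maps it to its
  counterpart in \<open>H\<close>; as \<open>\<phi>\<close> is a homeomorphism of open subgroups,
  convergence transfers both ways.\<close>

lemma E_star_iff_of_same_cosets:
  assumes x: "\<And>n. x n \<in> carrier G" and y: "\<And>n. y n \<in> carrier G"
    and same: "\<And>n. n > k \<Longrightarrow> x n \<otimes>\<^bsub>G\<^esub> inv\<^bsub>G\<^esub> (y n) \<in> N"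
  shows "(x, y) \<in> E_star G T \<longleftrightarrow> (\<lambda>n. \<psi> (x n), \<lambda>n. \<psi> (y n)) \<in> E_star H S"
proof -
  define p q where "p = prod_seq G x" and "q = prod_seq G y"
  define P Q where "P = prod_seq H (\<lambda>n. \<psi> (x n))" and "Q = prod_seq H (\<lambda>n. \<psi> (y n))"
  have [simp]: "p n \<in> carrier G" "q n \<in> carrier G" "P n \<in> carrier H" "Q n \<in> carrier H" for n
    using x y closed by (auto simp: p_def q_def P_def Q_def)
  have Suc_eq: "p (Suc n) = p n \<otimes>\<^bsub>G\<^esub> x (Suc n)" "q (Suc n) = q n \<otimes>\<^bsub>G\<^esub> y (Suc n)"
    "P (Suc n) = P n \<otimes>\<^bsub>H\<^esub> \<psi> (x (Suc n))" "Q (Suc n) = Q n \<otimes>\<^bsub>H\<^esub> \<psi> (y (Suc n))" for n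
    by (auto simp: p_def q_def P_def Q_def)
  \<comment> \<open>For \<open>n \<ge> k\<close>, \<open>u n\<close> is
    \<open>y (k+1) ... y n\<close>, and \<open>z n\<close> below is \<open>x (k+1) ... x n\<close>
    times \<open>inv (u n)\<close>; \<open>U\<close> and \<open>Z\<close> are the same for the
    images under \<open>\<psi>\<close>. All are the identity at \<open>n = k\<close>.\<close>
  define u U where "u n = inv\<^bsub>G\<^esub> (q k) \<otimes>\<^bsub>G\<^esub> q n" and "U n = inv\<^bsub>H\<^esub> (Q k) \<otimes>\<^bsub>H\<^esub> Q n" for n
  define z Z where "z n = inv\<^bsub>G\<^esub> (p k) \<otimes>\<^bsub>G\<^esub> (p n \<otimes>\<^bsub>G\<^esub> inv\<^bsub>G\<^esub> (q n)) \<otimes>\<^bsub>G\<^esub> q k"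
    and "Z n = inv\<^bsub>H\<^esub> (P k) \<otimes>\<^bsub>H\<^esub> (P n \<otimes>\<^bsub>H\<^esub> inv\<^bsub>H\<^esub> (Q n)) \<otimes>\<^bsub>H\<^esub> Q k" for n
  have [simp]: "u n \<in> carrier G" "U n \<in> carrier H" for n
    by (auto simp: u_def U_def)
  \<comment> \<open>Conjugation actions compose even where \<open>\<psi>\<close> is not
    multiplicative. \<open>c\<close> is left arbitrary because the induction hypothesis is applied
    to its conjugate by \<open>y (Suc n)\<close>.\<close>
  have u: "\<phi> (u n \<otimes>\<^bsub>G\<^esub> c \<otimes>\<^bsub>G\<^esub> inv\<^bsub>G\<^esub> (u n)) = U n \<otimes>\<^bsub>H\<^esub> \<phi> c \<otimes>\<^bsub>H\<^esub> inv\<^bsub>H\<^esub> (U n)"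
    if "n \<ge> k" "c \<in> N" for n c
    using that
  proof (induction n arbitrary: c rule: dec_induct)
    case base
    then show ?case using maps_subgroup by (simp add: u_def U_def)
  next
    case (step n)
    let ?c = "y (Suc n) \<otimes>\<^bsub>G\<^esub> c \<otimes>\<^bsub>G\<^esub> inv\<^bsub>G\<^esub> (y (Suc n))"
    have c: "?c \<in> N"
      using step.prems y by (simp add: N.inv_op_closed2)
    have "u (Suc n) = u n \<otimes>\<^bsub>G\<^esub> y (Suc n)" "U (Suc n) = U n \<otimes>\<^bsub>H\<^esub> \<psi> (y (Suc n))"
      using y closed by (auto simp: u_def U_def Suc_eq G.m_assoc H.m_assoc)
    moreover have "\<phi> ?c = \<psi> (y (Suc n)) \<otimes>\<^bsub>H\<^esub> \<phi> c \<otimes>\<^bsub>H\<^esub> inv\<^bsub>H\<^esub> (\<psi> (y (Suc n)))"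
      using y step.prems by (rule intertwine)
    ultimately show ?case
      using step.IH[OF c] step.prems y closed maps_subgroup[OF step.prems]
      by (simp add: G.m_assoc H.m_assoc G.inv_mult_group H.inv_mult_group)
  qed
  have z: "z n \<in> N \<and> \<phi> (z n) = Z n" if "n \<ge> k" for n
    using that
  proof (induction n rule: dec_induct)
    case base
    \<comment> \<open>This is \<open>coset\<close> with both elements the identity, whose image
      under \<open>\<psi>\<close> may be nontrivial.\<close>
    have "\<phi> \<one>\<^bsub>G\<^esub> = \<one>\<^bsub>H\<^esub>"
      using coset[of "\<one>\<^bsub>G\<^esub>" "\<one>\<^bsub>G\<^esub>"] closed by simp
    then show ?case
      by (simp add: z_def Z_def G.m_assoc H.m_assoc)
  next
    case (step n)
    let ?c = "x (Suc n) \<otimes>\<^bsub>G\<^esub> inv\<^bsub>G\<^esub> (y (Suc n))"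
    have c: "?c \<in> N" and uc: "u n \<otimes>\<^bsub>G\<^esub> ?c \<otimes>\<^bsub>G\<^esub> inv\<^bsub>G\<^esub> (u n) \<in> N"
      using same[of "Suc n"] step.hyps by (auto simp: N.inv_op_closed2)
    \<comment> \<open>Inserting \<open>inv (u n) \<otimes> u n\<close> turns new factors in the
      middle of the product into one factor from \<open>N\<close> on the right.\<close>
    have "z (Suc n) = z n \<otimes>\<^bsub>G\<^esub> (u n \<otimes>\<^bsub>G\<^esub> ?c \<otimes>\<^bsub>G\<^esub> inv\<^bsub>G\<^esub> (u n))"
      using x y by (simp add: z_def u_def Suc_eq G.m_assoc G.inv_mult_group)
    moreover have "Z (Suc n) = Z n \<otimes>\<^bsub>H\<^esub> (U n \<otimes>\<^bsub>H\<^esub> (\<psi> (x (Suc n)) \<otimes>\<^bsub>H\<^esub> inv\<^bsub>H\<^esub> (\<psi> (y (Suc n)))) \<otimes>\<^bsub>H\<^esub> inv\<^bsub>H\<^esub> (U n))"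
      using x y closed by (simp add: Z_def U_def Suc_eq H.m_assoc H.inv_mult_group)
    ultimately show ?case
      using step.IH uc u[OF step.hyps(1) c] coset[OF x y c] hom by simp
  qed
  obtain \<theta> where \<theta>: "homeomorphic_maps (subtopology T N) (subtopology S M) \<phi> \<theta>"
    using homeo homeomorphic_map_maps by blast
  have cont: "continuous_map (subtopology T N) S \<phi>" "continuous_map (subtopology S M) T \<theta>"
    using \<theta> by (auto simp: homeomorphic_maps_def continuous_map_in_subtopology)
  have "\<theta> (\<phi> c) = c" if "c \<in> N" for c
    using \<theta> that N.subset by (auto simp: homeomorphic_maps_def G.topspace_eq)
  then have \<theta>Z: "\<theta> (Z n) = z n" "Z n \<in> M" if "n \<ge> k" for n
    using z[OF that] maps_subgroup by metis+
  have "(x, y) \<in> E_star G T \<longleftrightarrow> (\<exists>l. limitin T z l sequentially)"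
    using x y unfolding z_def
    by (subst G.convergent_translate_iff) (auto simp: G.E_star_iff p_def q_def)
  also have "\<dots> \<longleftrightarrow> (\<exists>l. limitin S Z l sequentially)"
  proof
    assume "\<exists>l. limitin T z l sequentially"
    then obtain l where "limitin T z l sequentially" ..
    with z have "limitin S (\<lambda>n. \<phi> (z n)) (\<phi> l) sequentially"
      by (intro G.limitin_continuous_image_open_subgroup[OF N.subgroup_axioms N(2) _ _ cont(1)]) auto
    moreover have "\<forall>\<^sub>F n in sequentially. \<phi> (z n) = Z n"
      using z by (auto simp: eventually_sequentially)
    ultimately have "limitin S Z (\<phi> l) sequentially"
      by (rule limitin_transform_eventually[rotated])
    then show "\<exists>l. limitin S Z l sequentially" ..
  next
    assume "\<exists>l. limitin S Z l sequentially"
    then obtain l where "limitin S Z l sequentially" ..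
    with \<theta>Z have "limitin T (\<lambda>n. \<theta> (Z n)) (\<theta> l) sequentially"
      by (intro H.limitin_continuous_image_open_subgroup[OF M _ _ cont(2)]) auto
    moreover have "\<forall>\<^sub>F n in sequentially. \<theta> (Z n) = z n"
      using \<theta>Z by (auto simp: eventually_sequentially)
    ultimately have "limitin T z (\<theta> l) sequentially"
      by (rule limitin_transform_eventually[rotated])
    then show "\<exists>l. limitin T z l sequentially" ..
  qed
  also have "\<dots> \<longleftrightarrow> (\<lambda>n. \<psi> (x n), \<lambda>n. \<psi> (y n)) \<in> E_star H S"
    using x y closed unfolding Z_def
    by (subst H.convergent_translate_iff) (auto simp: H.E_star_iff P_def Q_def)
  finally show ?thesis .
qed

end

section \<open>Construction of the intertwiner\<close>

text \<open>The hypothesis on inner automorphisms gives some \<open>v g\<close> matching conjugation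
  by \<open>g\<close>, but the choices within a coset are unrelated. Hence \<open>v\<close> is used
  only at the representative \<open>s g\<close>, and \<open>\<phi>\<close> handles the factor
  \<open>b\<close> in \<open>g = b \<otimes> s g\<close>.\<close>

lemma coset_intertwiner_exists:
  assumes G: "topological_group G T" and H: "topological_group H S"
    and N: "N \<lhd> G" "openin T N" and M: "subgroup M H" "openin S M"
    and \<phi>: "\<phi> \<in> top_subgroup_iso G T N H S M"
    and conj: "conjugate_maps N M \<phi> (Inn G N) \<subseteq> Inn H M"
  obtains \<psi> where "coset_intertwiner G T H S N M \<phi> \<psi>"
proof -
  interpret G: topological_group G T by fact
  interpret H: topological_group H S by fact
  interpret N: normal N G by fact
  interpret M: subgroup M H by fact
  have homeo: "homeomorphic_map (subtopology T N) (subtopology S M) \<phi>"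
    and hom: "\<And>c d. \<lbrakk>c \<in> N; d \<in> N\<rbrakk> \<Longrightarrow> \<phi> (c \<otimes>\<^bsub>G\<^esub> d) = \<phi> c \<otimes>\<^bsub>H\<^esub> \<phi> d"
    and bij: "bij_betw \<phi> N M"
    using \<phi> by (auto simp: top_subgroup_iso_def Group.iso_def hom_def)
  have \<phi>M: "\<phi> c \<in> carrier H" if "c \<in> N" for c
    using bij that M.subset by (auto simp: bij_betw_def)
  have "\<exists>v. v \<in> carrier H \<and> (\<forall>c\<in>N. \<phi> (g \<otimes>\<^bsub>G\<^esub> c \<otimes>\<^bsub>G\<^esub> inv\<^bsub>G\<^esub> g) = v \<otimes>\<^bsub>H\<^esub> \<phi> c \<otimes>\<^bsub>H\<^esub> inv\<^bsub>H\<^esub> v)"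
    if g: "g \<in> carrier G" for g
  proof -
    have "compose M \<phi> (compose M (conj_map G N g) (inv_into N \<phi>)) \<in> Inn H M"
      using conj g by (auto simp: conjugate_maps_def Inn_def)
    then obtain v where v: "v \<in> carrier H"
      "compose M \<phi> (compose M (conj_map G N g) (inv_into N \<phi>)) = conj_map H M v"
      by (auto simp: Inn_def)
    \<comment> \<open>Evaluating the equality of maps at \<open>\<phi> c\<close> undoes
      \<open>inv_into\<close>.\<close>
    have "\<phi> (g \<otimes>\<^bsub>G\<^esub> c \<otimes>\<^bsub>G\<^esub> inv\<^bsub>G\<^esub> g) = v \<otimes>\<^bsub>H\<^esub> \<phi> c \<otimes>\<^bsub>H\<^esub> inv\<^bsub>H\<^esub> v" if c: "c \<in> N" for c
      using fun_cong[OF v(2), of "\<phi> c"] c bij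
      by (auto simp: compose_def conj_map_def bij_betw_def)
    with v(1) show ?thesis by blast
  qed
  then obtain v where v: "\<And>g. g \<in> carrier G \<Longrightarrow> v g \<in> carrier H"
    and v_conj: "\<And>g c. \<lbrakk>g \<in> carrier G; c \<in> N\<rbrakk> \<Longrightarrow>
      \<phi> (g \<otimes>\<^bsub>G\<^esub> c \<otimes>\<^bsub>G\<^esub> inv\<^bsub>G\<^esub> g) = v g \<otimes>\<^bsub>H\<^esub> \<phi> c \<otimes>\<^bsub>H\<^esub> inv\<^bsub>H\<^esub> (v g)"
    by metis
  \<comment> \<open>The choice is made from the coset as a set, so equal cosets yield equal
    representatives.\<close>
  define s where "s g = (SOME h. h \<in> N #>\<^bsub>G\<^esub> g)" for g
  have s_coset: "s g \<in> N #>\<^bsub>G\<^esub> g" if "g \<in> carrier G" for g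
    unfolding s_def using G.rcos_self[OF that N.subgroup_axioms] by (rule someI)
  have s: "s g \<in> carrier G" "g \<otimes>\<^bsub>G\<^esub> inv\<^bsub>G\<^esub> (s g) \<in> N" if g: "g \<in> carrier G" for g
  proof -
    obtain c where c: "c \<in> N" "s g = c \<otimes>\<^bsub>G\<^esub> g"
      using s_coset[OF g] by (auto simp: r_coset_def)
    then show "s g \<in> carrier G" "g \<otimes>\<^bsub>G\<^esub> inv\<^bsub>G\<^esub> (s g) \<in> N"
      using g by (auto simp: G.inv_mult_group)
  qed
  have s_cong: "s g = s h"
    if g: "g \<in> carrier G" and h: "h \<in> carrier G" and "g \<otimes>\<^bsub>G\<^esub> inv\<^bsub>G\<^esub> h \<in> N" for g h
  proof -
    have "g \<in> N #>\<^bsub>G\<^esub> h"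
      using that by (auto simp: r_coset_def G.m_assoc intro!: bexI[of _ "g \<otimes>\<^bsub>G\<^esub> inv\<^bsub>G\<^esub> h"])
    then have "N #>\<^bsub>G\<^esub> h = N #>\<^bsub>G\<^esub> g"
      using h N.subgroup_axioms by (rule G.repr_independence)
    then show ?thesis by (simp only: s_def)
  qed
  define \<psi> where "\<psi> g = \<phi> (g \<otimes>\<^bsub>G\<^esub> inv\<^bsub>G\<^esub> (s g)) \<otimes>\<^bsub>H\<^esub> v (s g)" for g
  have one: "\<phi> \<one>\<^bsub>G\<^esub> = \<one>\<^bsub>H\<^esub>"
    using hom[of "\<one>\<^bsub>G\<^esub>" "\<one>\<^bsub>G\<^esub>"] \<phi>M[of "\<one>\<^bsub>G\<^esub>"] by simp
  have inv: "\<phi> (inv\<^bsub>G\<^esub> c) = inv\<^bsub>H\<^esub> (\<phi> c)" if "c \<in> N" for c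
    using hom[of "inv\<^bsub>G\<^esub> c" c] that \<phi>M[of c] \<phi>M[of "inv\<^bsub>G\<^esub> c"] one
    by (simp add: H.inv_equality[symmetric])
  have "coset_intertwiner G T H S N M \<phi> \<psi>"
  proof (intro coset_intertwiner.intro coset_intertwiner_axioms.intro G H N M homeo hom)
    fix g assume g: "g \<in> carrier G"
    define b where "b = g \<otimes>\<^bsub>G\<^esub> inv\<^bsub>G\<^esub> (s g)"
    have b: "b \<in> N" "g = b \<otimes>\<^bsub>G\<^esub> s g"
      using s[OF g] g by (auto simp: b_def G.m_assoc)
    have \<psi>g: "\<psi> g = \<phi> b \<otimes>\<^bsub>H\<^esub> v (s g)"
      by (simp add: \<psi>_def b_def)
    show \<psi>c: "\<psi> g \<in> carrier H"
      using \<phi>M[OF b(1)] v[OF s(1)[OF g]] by (simp add: \<psi>g)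
    {
      fix c assume c: "c \<in> N"
      let ?c = "s g \<otimes>\<^bsub>G\<^esub> c \<otimes>\<^bsub>G\<^esub> inv\<^bsub>G\<^esub> (s g)"
      have c': "?c \<in> N"
        using s(1)[OF g] c by (rule N.inv_op_closed2)
      \<comment> \<open>Conjugation by \<open>g\<close> is conjugation by \<open>s g\<close>,
        matched by \<open>v (s g)\<close>, followed by conjugation by \<open>b\<close>, matched by
        \<open>\<phi> b\<close>.\<close>
      have "g \<otimes>\<^bsub>G\<^esub> c \<otimes>\<^bsub>G\<^esub> inv\<^bsub>G\<^esub> g = b \<otimes>\<^bsub>G\<^esub> ?c \<otimes>\<^bsub>G\<^esub> inv\<^bsub>G\<^esub> b"
        using s(1)[OF g] b(1) c by (subst (1 2) b(2)) (simp add: G.m_assoc G.inv_mult_group)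
      also have "\<phi> \<dots> = \<phi> b \<otimes>\<^bsub>H\<^esub> \<phi> ?c \<otimes>\<^bsub>H\<^esub> inv\<^bsub>H\<^esub> (\<phi> b)"
        using b(1) c' by (simp add: hom inv)
      also have "\<dots> = \<psi> g \<otimes>\<^bsub>H\<^esub> \<phi> c \<otimes>\<^bsub>H\<^esub> inv\<^bsub>H\<^esub> (\<psi> g)"
        unfolding v_conj[OF s(1)[OF g] c] \<psi>g
        using \<phi>M[OF b(1)] \<phi>M[OF c] v[OF s(1)[OF g]] by (simp add: H.m_assoc H.inv_mult_group)
      finally show "\<phi> (g \<otimes>\<^bsub>G\<^esub> c \<otimes>\<^bsub>G\<^esub> inv\<^bsub>G\<^esub> g) = \<psi> g \<otimes>\<^bsub>H\<^esub> \<phi> c \<otimes>\<^bsub>H\<^esub> inv\<^bsub>H\<^esub> (\<psi> g)" .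
    next
      fix h assume h: "h \<in> carrier G" and gh: "g \<otimes>\<^bsub>G\<^esub> inv\<^bsub>G\<^esub> h \<in> N"
      \<comment> \<open>\<open>h\<close> has the same representative as \<open>g\<close>, so
        \<open>v (s g)\<close> cancels from the quotient of \<open>\<psi> g\<close> and
        \<open>\<psi> h\<close>.\<close>
      define b' where "b' = h \<otimes>\<^bsub>G\<^esub> inv\<^bsub>G\<^esub> (s g)"
      have sh: "s h = s g"
        using s_cong[OF g h gh] by simp
      have b': "b' \<in> N"
        using s(2)[OF h] by (simp add: b'_def sh)
      have \<psi>h: "\<psi> h = \<phi> b' \<otimes>\<^bsub>H\<^esub> v (s g)"
        by (simp add: \<psi>_def b'_def sh)
      have "g \<otimes>\<^bsub>G\<^esub> inv\<^bsub>G\<^esub> h = b \<otimes>\<^bsub>G\<^esub> inv\<^bsub>G\<^esub> b'"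
        using g h s(1)[OF g] by (simp add: b_def b'_def G.m_assoc G.inv_mult_group)
      also have "\<phi> \<dots> = \<phi> b \<otimes>\<^bsub>H\<^esub> inv\<^bsub>H\<^esub> (\<phi> b')"
        using b(1) b' by (simp add: hom inv)
      also have "\<dots> = \<psi> g \<otimes>\<^bsub>H\<^esub> inv\<^bsub>H\<^esub> (\<psi> h)"
        unfolding \<psi>g \<psi>h using \<phi>M[OF b(1)] \<phi>M[OF b'] v[OF s(1)[OF g]]
        by (simp add: H.m_assoc H.inv_mult_group)
      finally show "\<phi> (g \<otimes>\<^bsub>G\<^esub> inv\<^bsub>G\<^esub> h) = \<psi> g \<otimes>\<^bsub>H\<^esub> inv\<^bsub>H\<^esub> (\<psi> h)" .
    }
  qed
  then show thesis by (rule that)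
qed

section \<open>Coding sequences of naturals by bits modulo finite changes\<close>

text \<open>The characteristic function of the graph of \<open>c\<close>, with pairs enumerated by
  \<open>prod_decode\<close>. Infinitely many possible values become two, which
  \<open>\<one>\<close> and \<open>a\<close> in \<open>H\<close> can represent.\<close>

definition graph_bit :: "(nat \<Rightarrow> nat) \<Rightarrow> nat \<Rightarrow> bool" where
  "graph_bit c n \<longleftrightarrow> c (fst (prod_decode n)) = snd (prod_decode n)"

text \<open>The pair \<open>(i, c i)\<close> has an index at least \<open>i\<close>, so late
  agreement of bits gives late agreement of values. Conversely, bits can differ only at the finitely
  many graph points of \<open>c\<close> or \<open>c'\<close> with first coordinate below
  \<open>k\<close>.\<close>

lemma eventually_graph_bit_eq_iff:
  "(\<forall>\<^sub>F n in sequentially. graph_bit c n = graph_bit c' n) \<longleftrightarrow>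
   (\<forall>\<^sub>F n in sequentially. c n = c' n)"
proof
  assume "\<forall>\<^sub>F n in sequentially. graph_bit c n = graph_bit c' n"
  then obtain k where k: "\<And>n. n \<ge> k \<Longrightarrow> graph_bit c n = graph_bit c' n"
    by (auto simp: eventually_sequentially)
  have "c i = c' i" if "i \<ge> k" for i
    using k[of "prod_encode (i, c i)"] that le_prod_encode_1[of i "c i"]
    by (simp add: graph_bit_def)
  then show "\<forall>\<^sub>F n in sequentially. c n = c' n"
    by (auto simp: eventually_sequentially)
next
  assume "\<forall>\<^sub>F n in sequentially. c n = c' n"
  then obtain k where k: "\<And>n. n \<ge> k \<Longrightarrow> c n = c' n"
    by (auto simp: eventually_sequentially)
  have "{n. graph_bit c n \<noteq> graph_bit c' n} \<subseteq>
    (\<lambda>i. prod_encode (i, c i)) ` {..<k} \<union> (\<lambda>i. prod_encode (i, c' i)) ` {..<k}"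
  proof
    fix n assume n: "n \<in> {n. graph_bit c n \<noteq> graph_bit c' n}"
    obtain i j where ij: "n = prod_encode (i, j)"
      by (metis prod_decode_inverse surj_pair)
    show "n \<in> (\<lambda>i. prod_encode (i, c i)) ` {..<k} \<union> (\<lambda>i. prod_encode (i, c' i)) ` {..<k}"
      using n k[of i] by (cases "i < k") (auto simp: ij graph_bit_def)
  qed
  then have "finite {n. graph_bit c n \<noteq> graph_bit c' n}"
    by (rule finite_subset) simp
  then show "\<forall>\<^sub>F n in sequentially. graph_bit c n = graph_bit c' n"
    by (simp add: cofinite_eq_sequentially[symmetric] eventually_cofinite)
qed

section \<open>Borel measurability and the reduction\<close>

lemma measurable_borel_of_continuous_map:
  assumes "continuous_map X Y f"
  shows "f \<in> borel_of X \<rightarrow>\<^sub>M borel_of Y"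
proof -
  have sub: "{U. openin Z U} \<subseteq> Pow (topspace Z)" for Z :: "'z topology"
    using openin_subset by auto
  have space: "space (borel_of X) = topspace X"
    using sub[of X] by (simp add: borel_of_def)
  show ?thesis
    unfolding borel_of_def[of Y]
  proof (rule measurable_measure_of[OF sub])
    show "f \<in> space (borel_of X) \<rightarrow> topspace Y"
      using assms by (auto simp: space continuous_map_def)
    fix U assume "U \<in> {U. openin Y U}"
    then have "openin X {x \<in> topspace X. f x \<in> U}"
      using assms by (auto intro: openin_continuous_map_preimage)
    moreover have "f -` U \<inter> space (borel_of X) = {x \<in> topspace X. f x \<in> U}"
      by (auto simp: space)
    ultimately show "f -` U \<inter> space (borel_of X) \<in> sets (borel_of X)"
      using sub[of X] by (auto simp: borel_of_def)
  qed
qed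

theorem theorem6p7:
  fixes G :: "('a, 'm) monoid_scheme" and T :: "'a topology"
    and H :: "('b, 'n) monoid_scheme" and S :: "'b topology"
    and Gc :: "'a set" and Hc :: "'b set"
  assumes "tsi_polish_group G T" and "tsi_polish_group H S"
    and "\<exists>x\<in>carrier G. \<exists>y\<in>carrier G. x \<noteq> y"
    and "\<exists>x\<in>carrier H. \<exists>y\<in>carrier H. x \<noteq> y"
    and "Gc \<lhd> G" and "openin T Gc"
    and "Hc \<lhd> H" and "openin S Hc"
    and "\<exists>\<phi> \<in> top_subgroup_iso G T Gc H S Hc.
           conjugate_maps Gc Hc \<phi> (Inn G Gc) \<subseteq> Inn H Hc"
  shows "borel_reducible (omega_power T) (E_star G T) (omega_power S) (E_star H S)"
proof -
  interpret G: tsi_polish_group G T by fact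
  interpret H: tsi_polish_group H S by fact
  obtain \<phi> where \<phi>: "\<phi> \<in> top_subgroup_iso G T Gc H S Hc"
    "conjugate_maps Gc Hc \<phi> (Inn G Gc) \<subseteq> Inn H Hc"
    using assms(9) by blast
  obtain \<psi> where "coset_intertwiner G T H S Gc Hc \<phi> \<psi>"
    using coset_intertwiner_exists[OF G.topological_group_axioms H.topological_group_axioms
        assms(5,6) normal_imp_subgroup[OF assms(7)] assms(8) \<phi>] .
  then interpret coset_intertwiner G T H S Gc Hc \<phi> \<psi> .
  obtain code :: "'a \<Rightarrow> nat" where code:
    "\<And>g h. \<lbrakk>g \<in> carrier G; h \<in> carrier G\<rbrakk> \<Longrightarrow> code g = code h \<longleftrightarrow> g \<otimes>\<^bsub>G\<^esub> inv\<^bsub>G\<^esub> h \<in> Gc"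
    using G.coset_code_exists[OF N.subgroup_axioms assms(6)] by blast
  \<comment> \<open>Of two distinct elements at least one is not the identity.\<close>
  obtain a where a: "a \<in> carrier H" "a \<noteq> \<one>\<^bsub>H\<^esub>"
    using assms(4) by metis
  define e where "e x n = (if graph_bit (\<lambda>i. code (x i)) n then a else \<one>\<^bsub>H\<^esub>)" for x n
  define f where "f x = interleave H (\<lambda>n. \<psi> (x n)) (e x)" for x
  have e: "e x n \<in> {\<one>\<^bsub>H\<^esub>, a}" for x n
    by (simp add: e_def)
  have proj: "continuous_map (omega_power T) T (\<lambda>x. x i)" for i
    by (rule continuous_map_product_projection) simp
  \<comment> \<open>\<open>code\<close> is constant on each open coset, hence continuous into a
    discrete space.\<close>
  have "continuous_map T (discrete_topology UNIV) code"
  proof (rule pasting_lemma[where I = "carrier G" and f = "\<lambda>h _. code h"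
        and T = "\<lambda>h. {g \<in> carrier G. g \<otimes>\<^bsub>G\<^esub> inv\<^bsub>G\<^esub> h \<in> Gc}"])
    show "openin T {g \<in> carrier G. g \<otimes>\<^bsub>G\<^esub> inv\<^bsub>G\<^esub> h \<in> Gc}" if "h \<in> carrier G" for h
      using assms(6) that by (rule G.openin_coset)
    show "code h = code h'"
      if "h \<in> carrier G" "h' \<in> carrier G"
        "g \<in> topspace T \<inter> {g \<in> carrier G. g \<otimes>\<^bsub>G\<^esub> inv\<^bsub>G\<^esub> h \<in> Gc} \<inter> {g \<in> carrier G. g \<otimes>\<^bsub>G\<^esub> inv\<^bsub>G\<^esub> h' \<in> Gc}"
      for h h' g
      using that code[of g h] code[of g h'] by auto
  qed (auto simp: G.topspace_eq)
  then have code_cont: "continuous_map (omega_power T) (discrete_topology UNIV) (\<lambda>x. code (x i))" for i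
    using continuous_map_compose[OF proj] by (auto simp: o_def)
  \<comment> \<open>Bit \<open>n\<close> asks whether \<open>code (x i) = j\<close> for one fixed
    pair \<open>(i, j)\<close>, so it depends on a single coordinate of \<open>x\<close>.\<close>
  have e_cont: "continuous_map (omega_power T) S (\<lambda>x. e x n)" for n
  proof -
    obtain i j where ij: "prod_decode n = (i, j)"
      by force
    have "continuous_map (discrete_topology UNIV) S (\<lambda>m. if m = j then a else \<one>\<^bsub>H\<^esub>)"
      using a by (simp add: H.topspace_eq)
    from continuous_map_compose[OF code_cont[of i] this] show ?thesis
      by (simp add: o_def e_def graph_bit_def ij)
  qed
  have \<psi>_cont: "continuous_map (omega_power T) S (\<lambda>x. \<psi> (x n))" for n
    using continuous_map_compose[OF proj continuous_map_intertwiner] by (simp add: o_def)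
  have "continuous_map (omega_power T) (omega_power S) f"
    unfolding continuous_map_componentwise_UNIV
  proof
    fix n
    show "continuous_map (omega_power T) S (\<lambda>x. f x n)"
      by (cases "even n")
        (simp_all add: f_def interleave_def H.continuous_map_mult H.continuous_map_inv \<psi>_cont e_cont)
  qed
  then have "f \<in> borel_of (omega_power T) \<rightarrow>\<^sub>M borel_of (omega_power S)"
    by (rule measurable_borel_of_continuous_map)
  moreover have "(x, y) \<in> E_star G T \<longleftrightarrow> (f x, f y) \<in> E_star H S"
    if "x \<in> topspace (omega_power T)" "y \<in> topspace (omega_power T)" for x y
  proof -
    have x: "x n \<in> carrier G" and y: "y n \<in> carrier G" for n
      using that unfolding G.topspace_omega_power_iff by auto
    let ?same = "\<forall>\<^sub>F n in sequentially. x n \<otimes>\<^bsub>G\<^esub> inv\<^bsub>G\<^esub> (y n) \<in> Gc"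
    have "(\<forall>\<^sub>F n in sequentially. e x n = e y n) \<longleftrightarrow>
      (\<forall>\<^sub>F n in sequentially. graph_bit (\<lambda>i. code (x i)) n = graph_bit (\<lambda>i. code (y i)) n)"
      using a(2) by (intro eventually_cong[OF always_eventually]) (auto simp: e_def)
    also have "\<dots> \<longleftrightarrow> ?same"
      unfolding eventually_graph_bit_eq_iff using code x y by simp
    finally have "(f x, f y) \<in> E_star H S \<longleftrightarrow>
      (\<lambda>n. \<psi> (x n), \<lambda>n. \<psi> (y n)) \<in> E_star H S \<and> ?same"
      unfolding f_def using x y closed by (subst H.E_star_interleave_iff[OF _ _ a e e]) auto
    moreover have "(x, y) \<in> E_star G T \<longleftrightarrow> (\<lambda>n. \<psi> (x n), \<lambda>n. \<psi> (y n)) \<in> E_star H S" if same: ?same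
    proof -
      obtain k where "\<And>n. n > k \<Longrightarrow> x n \<otimes>\<^bsub>G\<^esub> inv\<^bsub>G\<^esub> (y n) \<in> Gc"
        using same by (auto simp: eventually_at_top_dense)
      with x y show ?thesis by (rule E_star_iff_of_same_cosets)
    qed
    \<comment> \<open>If \<open>?same\<close> fails, both sides are false: the left by this, the
      right by the equivalence for \<open>f\<close>. If it holds, the comparison of tails
      decides.\<close>
    moreover have "(x, y) \<in> E_star G T \<Longrightarrow> ?same"
      using assms(5,6) by (rule G.E_star_imp_eventually_same_coset)
    ultimately show ?thesis by blast
  qed
  ultimately show ?thesis
    unfolding borel_reducible_def by blast
qed

end
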